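(* Let $\mathbb{K}$ be $\mathbb{R}$ or $\mathbb{C}$, let $m\geq 3$ be an integer and let $\sigma_1,\dots,\sigma_{m-2}$ be bijections from $\mathbb{N}\times\mathbb{N}$ to $\mathbb{N}$. Then $$\left(\sum_{i,j=1}^{\infty}\left\vert U\left(e_i,e_j,e_{\sigma_1(i,j)},\dots,e_{\sigma_{m-2}(i,j)}\right)\right\vert^{\frac43}\right)^{\frac34}\leq\sqrt2\,\Vert U\Vert$$ for every continuous $m$-linear form $U:c_0\times\cdots\times c_0\to\mathbb{K}$.
   Context: $\mathbb{N}=\{1,2,3,\dots\}$. $c_0$ is the Banach space of sequences in $\mathbb{K}$ converging to $0$, with the sup norm, and $e_j\in c_0$ is the canonical vector with $1$ in the $j$-th coordinate and $0$ elsewhere. For a continuous $m$-linear form $U$ on $c_0\times\cdots\times c_0$ ($m$ factors), $\Vert U\Vert=\sup\{|U(x_1,\dots,x_m)|:\Vert x_k\Vert\le1\}$. *)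

theory Defs
  imports "HOL-Analysis.Analysis"
begin

text \<open>
  Sequences are indexed by the type \<^typ>\<open>nat\<close>, which starts at \<open>0\<close>; it is used
  purely as a countable label set in place of \<open>{1, 2, 3, \<dots>}\<close>.
\<close>

typedef (overloaded) 'k c0 = "{x :: nat \<Rightarrow> 'k :: real_normed_field. x \<longlonglongrightarrow> 0}"
  morphisms c0_nth Abs_c0
  by (rule exI[of _ "\<lambda>_. 0"]) simp

setup_lifting type_definition_c0

lemma c0_nth_tendsto: "c0_nth x \<longlonglongrightarrow> 0"
  using c0_nth[of x] by simp

lemma c0_eqI: "(\<And>n. c0_nth x n = c0_nth y n) \<Longrightarrow> x = y"
  by (simp add: c0_nth_inject[symmetric] fun_eq_iff)

lemma c0_bdd_above: "bdd_above (range (\<lambda>n. norm (c0_nth x n)))"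
proof -
  have "Bseq (c0_nth x)"
    using c0_nth_tendsto convergentI convergent_imp_Bseq by blast
  then show ?thesis
    by (auto simp: Bseq_def bdd_above_def)
qed

lift_definition c0_scale :: "'k :: real_normed_field \<Rightarrow> 'k c0 \<Rightarrow> 'k c0"
  is "\<lambda>a x n. a * x n"
  by (rule tendsto_mult_right_zero)

lift_definition c0_unit :: "nat \<Rightarrow> 'k :: real_normed_field c0"
  is "\<lambda>j n. if n = j then 1 else 0"
proof -
  fix j :: nat
  have "eventually (\<lambda>n. (if n = j then 1 else 0 :: 'k) = 0) sequentially"
    by (rule eventually_mono[OF eventually_gt_at_top[of j]]) simp
  then show "(\<lambda>n. if n = j then 1 else 0 :: 'k) \<longlonglongrightarrow> 0"
    by (rule tendsto_eventually)
qed

instantiation c0 :: (real_normed_field) real_normed_vector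
begin

lift_definition zero_c0 :: "'a c0" is "\<lambda>_. 0"
  by simp

lift_definition plus_c0 :: "'a c0 \<Rightarrow> 'a c0 \<Rightarrow> 'a c0" is "\<lambda>x y n. x n + y n"
  by (rule tendsto_add_zero)

lift_definition uminus_c0 :: "'a c0 \<Rightarrow> 'a c0" is "\<lambda>x n. - x n"
  using tendsto_minus by fastforce

lift_definition minus_c0 :: "'a c0 \<Rightarrow> 'a c0 \<Rightarrow> 'a c0" is "\<lambda>x y n. x n - y n"
  using tendsto_diff by fastforce

lift_definition scaleR_c0 :: "real \<Rightarrow> 'a c0 \<Rightarrow> 'a c0" is "\<lambda>r x n. r *\<^sub>R x n"
  using tendsto_scaleR[OF tendsto_const] by fastforce

definition norm_c0 :: "'a c0 \<Rightarrow> real" where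
  "norm_c0 x = (SUP n. norm (c0_nth x n))"

definition dist_c0 :: "'a c0 \<Rightarrow> 'a c0 \<Rightarrow> real" where
  "dist_c0 x y = norm (x - y)"

definition sgn_c0 :: "'a c0 \<Rightarrow> 'a c0" where
  "sgn_c0 x = inverse (norm x) *\<^sub>R x"

definition uniformity_c0 :: "('a c0 \<times> 'a c0) filter" where
  "uniformity_c0 = (INF e\<in>{0<..}. principal {(x, y). dist x y < e})"

definition open_c0 :: "'a c0 set \<Rightarrow> bool" where
  "open_c0 S = (\<forall>x\<in>S. \<forall>\<^sub>F (x', y) in uniformity. x' = x \<longrightarrow> y \<in> S)"

instance
proof
  fix x y z :: "'a c0" and a b :: real and S :: "'a c0 set"
  show "x + y + z = x + (y + z)" "x + y = y + x" "0 + x = x" "- x + x = 0" "x - y = x + - y"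
    by (transfer; auto simp: algebra_simps)+
  show "a *\<^sub>R (x + y) = a *\<^sub>R x + a *\<^sub>R y" "(a + b) *\<^sub>R x = a *\<^sub>R x + b *\<^sub>R x"
    "a *\<^sub>R b *\<^sub>R x = (a * b) *\<^sub>R x" "1 *\<^sub>R x = x"
    by (transfer; auto simp: algebra_simps)+
  show "dist x y = norm (x - y)" "sgn x = inverse (norm x) *\<^sub>R x"
    "uniformity = (INF e\<in>{0<..}. principal {(x, y :: 'a c0). dist x y < e})"
    "open S = (\<forall>x\<in>S. \<forall>\<^sub>F (x', y) in uniformity. x' = x \<longrightarrow> y \<in> S)"
    by (simp_all add: dist_c0_def sgn_c0_def uniformity_c0_def open_c0_def)
  have nth: "norm (c0_nth w n) \<le> norm w" for w :: "'a c0" and n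
    unfolding norm_c0_def by (rule cSUP_upper[OF UNIV_I c0_bdd_above])
  show "norm x = 0 \<longleftrightarrow> x = 0"
  proof
    assume "norm x = 0"
    then show "x = 0"
      using nth[of x] by (intro c0_eqI) (simp add: zero_c0.rep_eq)
  qed (simp add: norm_c0_def zero_c0.rep_eq)
  show "norm (x + y) \<le> norm x + norm y"
    unfolding norm_c0_def[of "x + y"]
  proof (rule cSUP_least)
    fix n
    show "norm (c0_nth (x + y) n) \<le> norm x + norm y"
      using norm_triangle_ineq[of "c0_nth x n" "c0_nth y n"] nth[of x n] nth[of y n]
      by (simp add: plus_c0.rep_eq)
  qed simp
  have le: "norm (r *\<^sub>R w) \<le> \<bar>r\<bar> * norm w" for r and w :: "'a c0"
    unfolding norm_c0_def[of "r *\<^sub>R w"]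
    by (rule cSUP_least) (simp_all add: scaleR_c0.rep_eq mult_left_mono nth)
  show "norm (a *\<^sub>R x) = \<bar>a\<bar> * norm x"
  proof (cases "a = 0")
    case True
    then show ?thesis
      by (simp add: norm_c0_def scaleR_c0.rep_eq)
  next
    case False
    have "inverse a *\<^sub>R a *\<^sub>R x = x"
      using False by transfer simp
    then have "\<bar>a\<bar> * norm x \<le> norm (a *\<^sub>R x)"
      using le[of "inverse a" "a *\<^sub>R x"] False by (simp add: field_simps)
    then show ?thesis
      using le[of a x] by simp
  qed
qed

end

lemma norm_c0_nth_le: "norm (c0_nth x n) \<le> norm x"
  unfolding norm_c0_def by (rule cSUP_upper[OF UNIV_I c0_bdd_above])

lemma norm_c0_leI: "(\<And>n. norm (c0_nth x n) \<le> B) \<Longrightarrow> norm x \<le> B"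
  unfolding norm_c0_def by (rule cSUP_least) auto

instance c0 :: ("{real_normed_field, banach}") banach
proof
  fix X :: "nat \<Rightarrow> 'a c0"
  assume X: "Cauchy X"
  have "Cauchy (\<lambda>k. c0_nth (X k) n)" for n
  proof (rule CauchyI)
    fix e :: real
    assume "e > 0"
    then obtain M where M: "\<And>k l. k \<ge> M \<Longrightarrow> l \<ge> M \<Longrightarrow> norm (X k - X l) < e"
      using CauchyD[OF X] by blast
    have "norm (c0_nth (X k) n - c0_nth (X l) n) < e" if "k \<ge> M" "l \<ge> M" for k l
      using M[OF that] norm_c0_nth_le[of "X k - X l" n] by (simp add: minus_c0.rep_eq)
    then show "\<exists>M. \<forall>k\<ge>M. \<forall>l\<ge>M. norm (c0_nth (X k) n - c0_nth (X l) n) < e"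
      by blast
  qed
  then obtain y where y: "\<And>n. (\<lambda>k. c0_nth (X k) n) \<longlonglongrightarrow> y n"
    unfolding Cauchy_convergent_iff convergent_def by metis
  have unif: "\<exists>M. \<forall>k\<ge>M. \<forall>n. norm (c0_nth (X k) n - y n) \<le> e" if "e > 0" for e
  proof -
    obtain M where M: "\<And>k l. k \<ge> M \<Longrightarrow> l \<ge> M \<Longrightarrow> norm (X k - X l) < e"
      using CauchyD[OF X \<open>e > 0\<close>] by blast
    have "norm (c0_nth (X k) n - y n) \<le> e" if k: "k \<ge> M" for k n
    proof (rule tendsto_upperbound)
      show "(\<lambda>l. norm (c0_nth (X k) n - c0_nth (X l) n)) \<longlonglongrightarrow> norm (c0_nth (X k) n - y n)"
        by (intro tendsto_intros y)
      have "norm (c0_nth (X k) n - c0_nth (X l) n) \<le> e" if "l \<ge> M" for l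
        using M[OF k that] norm_c0_nth_le[of "X k - X l" n] by (simp add: minus_c0.rep_eq)
      then show "\<forall>\<^sub>F l in sequentially. norm (c0_nth (X k) n - c0_nth (X l) n) \<le> e"
        using eventually_sequentially by blast
    qed simp
    then show ?thesis by blast
  qed
  have "y \<longlonglongrightarrow> 0"
  proof (rule LIMSEQ_I)
    fix e :: real
    assume e: "e > 0"
    then obtain M where M: "\<And>n. norm (c0_nth (X M) n - y n) \<le> e / 2"
      using unif[of "e / 2"] by auto
    obtain N where N: "\<And>n. n \<ge> N \<Longrightarrow> norm (c0_nth (X M) n) < e / 2"
      using LIMSEQ_D[OF c0_nth_tendsto[of "X M"], of "e / 2"] e by auto
    have "norm (y n) < e" if "n \<ge> N" for n
      using N[OF that] M[of n] norm_triangle_ineq4[of "c0_nth (X M) n" "c0_nth (X M) n - y n"]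
      by simp
    then show "\<exists>N. \<forall>n\<ge>N. norm (y n - 0) < e"
      by auto
  qed
  then have nth: "c0_nth (Abs_c0 y) = y"
    by (simp add: Abs_c0_inverse)
  have "X \<longlonglongrightarrow> Abs_c0 y"
  proof (rule LIMSEQ_I)
    fix e :: real
    assume e: "e > 0"
    then obtain M where M: "\<forall>k\<ge>M. \<forall>n. norm (c0_nth (X k) n - y n) \<le> e / 2"
      using unif[of "e / 2"] by auto
    have "norm (X k - Abs_c0 y) \<le> e / 2" if "k \<ge> M" for k
      using M that by (intro norm_c0_leI) (simp add: minus_c0.rep_eq nth)
    then show "\<exists>M. \<forall>k\<ge>M. norm (X k - Abs_c0 y) < e"
      using e by force
  qed
  then show "convergent X"
    by (rule convergentI)
qed

lemma vector_space_c0_scale: "vector_space (c0_scale :: 'k \<Rightarrow> 'k :: real_normed_field c0 \<Rightarrow> 'k c0)"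
  by (unfold_locales; transfer; simp add: algebra_simps)

lemma vector_space_field_mult: "vector_space ((*) :: 'k \<Rightarrow> 'k :: field \<Rightarrow> 'k)"
  by unfold_locales (simp_all add: algebra_simps)

text \<open>
  The \<open>m\<close>-fold product of \<open>c0\<close> is the set of extensional functions on \<open>{1..m}\<close>, that is,
  the carrier of the product topology below; values of \<open>U\<close> elsewhere are irrelevant.
  Linearity is over the scalar field \<open>'k\<close> itself, not only over the reals.
\<close>

definition continuous_multilinear_form ::
    "nat \<Rightarrow> ((nat \<Rightarrow> 'k c0) \<Rightarrow> 'k :: real_normed_field) \<Rightarrow> bool" where
  "continuous_multilinear_form m U \<longleftrightarrow>
     (\<forall>x \<in> {1..m} \<rightarrow>\<^sub>E UNIV. \<forall>k \<in> {1..m}.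
        Vector_Spaces.linear c0_scale (*) (\<lambda>y. U (x(k := y)))) \<and>
     continuous_map (product_topology (\<lambda>_. euclidean) {1..m}) euclidean U"

definition form_norm :: "nat \<Rightarrow> ((nat \<Rightarrow> 'k c0) \<Rightarrow> 'k :: real_normed_field) \<Rightarrow> real" where
  "form_norm m U = (SUP x \<in> {x \<in> {1..m} \<rightarrow>\<^sub>E UNIV. \<forall>k \<in> {1..m}. norm (x k) \<le> 1}. norm (U x))"

definition unit_args ::
    "nat \<Rightarrow> (nat \<Rightarrow> nat \<times> nat \<Rightarrow> nat) \<Rightarrow> nat \<times> nat \<Rightarrow> (nat \<Rightarrow> 'k :: real_normed_field c0)" where
  "unit_args m \<sigma> = (\<lambda>(i, j). \<lambda>k\<in>{1..m}.
     if k = 1 then c0_unit i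
     else if k = 2 then c0_unit j
     else c0_unit (\<sigma> (k - 2) (i, j)))"

end

theory Submission
  imports Defs
begin

text \<open>
  Write \<open>a\<^sub>i\<^sub>j = U (e\<^sub>i, e\<^sub>j, e\<^bsub>\<sigma>\<^sub>1(i,j)\<^esub>, \<dots>)\<close>. Averaging over random signs \<open>r\<^sub>i, s\<^sub>j\<close> selects the
  diagonal of the form in one of the remaining arguments at a time, so the bilinear form with
  matrix \<open>a\<close> has norm at most that of \<open>U\<close>, and Littlewood's \<open>4/3\<close> inequality applies to it.
  Littlewood's inequality with constant \<open>\<surd>2\<close> rests on Khinchine's inequality with the same
  constant, for which we follow Latala and Oleszkiewicz: the function \<open>\<parallel>\<Sum> \<epsilon>\<^sub>i v\<^sub>i\<parallel>\<close> on the discrete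
  cube is even, so its variance is controlled with the second eigenvalue of the cube's Laplacian,
  while the triangle inequality bounds the Laplacian of the function by the function itself. This
  works in every inner product space, and hence for real and complex scalars alike.
\<close>

subsection \<open>Averages over the discrete cube\<close>

text \<open>A vertex of the cube \<open>{-1, 1}\<^sup>I\<close> is encoded as the set of its negative coordinates.\<close>

definition cube_sign :: "'i set \<Rightarrow> 'i \<Rightarrow> real" where
  "cube_sign A i = (if i \<in> A then -1 else 1)"

definition cube_flip :: "'i \<Rightarrow> 'i set \<Rightarrow> 'i set" where
  "cube_flip i A = (if i \<in> A then A - {i} else insert i A)"

definition cube_mean :: "'i set \<Rightarrow> ('i set \<Rightarrow> real) \<Rightarrow> real" where
  "cube_mean I f = (\<Sum>A\<in>Pow I. f A) / 2 ^ card I"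

lemma cube_mean_cong: "(\<And>A. A \<subseteq> I \<Longrightarrow> f A = g A) \<Longrightarrow> cube_mean I f = cube_mean I g"
  unfolding cube_mean_def by (intro arg_cong2[of _ _ _ _ "(/)"] sum.cong) auto

lemma cube_mean_mono: "(\<And>A. A \<subseteq> I \<Longrightarrow> f A \<le> g A) \<Longrightarrow> cube_mean I f \<le> cube_mean I g"
  unfolding cube_mean_def by (intro divide_right_mono sum_mono) auto

lemma cube_mean_add: "cube_mean I (\<lambda>A. f A + g A) = cube_mean I f + cube_mean I g"
  by (simp add: cube_mean_def sum.distrib add_divide_distrib)

lemma cube_mean_diff: "cube_mean I (\<lambda>A. f A - g A) = cube_mean I f - cube_mean I g"
  by (simp add: cube_mean_def sum_subtractf diff_divide_distrib)

lemma cube_mean_minus: "cube_mean I (\<lambda>A. - f A) = - cube_mean I f"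
  by (simp add: cube_mean_def sum_negf)

lemma cube_mean_cmult: "cube_mean I (\<lambda>A. c * f A) = c * cube_mean I f"
  by (simp add: cube_mean_def sum_distrib_left)

lemma cube_mean_sum: "cube_mean I (\<lambda>A. \<Sum>j\<in>J. f j A) = (\<Sum>j\<in>J. cube_mean I (f j))"
  unfolding cube_mean_def by (subst sum.swap) (simp add: sum_divide_distrib)

lemma cube_mean_const: "finite I \<Longrightarrow> cube_mean I (\<lambda>_. c) = c"
  by (simp add: cube_mean_def card_Pow)

lemma cube_mean_empty [simp]: "cube_mean {} f = f {}"
  by (simp add: cube_mean_def)

lemma cube_mean_nonneg: "(\<And>A. A \<subseteq> I \<Longrightarrow> f A \<ge> 0) \<Longrightarrow> cube_mean I f \<ge> 0"
  unfolding cube_mean_def by (intro divide_nonneg_nonneg sum_nonneg) auto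

lemma cube_mean_insert:
  assumes "finite I" "x \<notin> I"
  shows "cube_mean (insert x I) f = cube_mean I (\<lambda>A. (f A + f (insert x A)) / 2)"
proof -
  have inj: "inj_on (insert x) (Pow I)"
    using assms(2) by (auto simp: inj_on_def)
  have "(\<Sum>A\<in>Pow (insert x I). f A) = (\<Sum>A\<in>Pow I. f A) + (\<Sum>A\<in>insert x ` Pow I. f A)"
    unfolding Pow_insert using assms by (intro sum.union_disjoint) auto
  also have "(\<Sum>A\<in>insert x ` Pow I. f A) = (\<Sum>A\<in>Pow I. f (insert x A))"
    using inj by (simp add: sum.reindex)
  finally show ?thesis
    using assms by (simp add: cube_mean_def sum.distrib sum_divide_distrib[symmetric] add_divide_distrib)
qed

lemma cube_mean_reindex:
  assumes "bij_betw \<phi> (Pow I) (Pow I)"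
  shows "cube_mean I (\<lambda>A. f (\<phi> A)) = cube_mean I f"
  unfolding cube_mean_def using sum.reindex_bij_betw[OF assms, of f] by simp

lemma cube_mean_flip: "i \<in> I \<Longrightarrow> cube_mean I (\<lambda>A. f (cube_flip i A)) = cube_mean I f"
  by (rule cube_mean_reindex, rule bij_betw_byWitness[where f' = "cube_flip i"])
    (auto simp: cube_flip_def)

lemma cube_mean_compl: "cube_mean I (\<lambda>A. f (I - A)) = cube_mean I f"
  by (rule cube_mean_reindex, rule bij_betw_byWitness[where f' = "\<lambda>A. I - A"]) auto

section \<open>Dirichlet energy and Poincare inequalities on the cube\<close>

definition cube_energy :: "'i set \<Rightarrow> ('i set \<Rightarrow> real) \<Rightarrow> real" where
  "cube_energy I f = (\<Sum>i\<in>I. cube_mean I (\<lambda>A. (f A - f (cube_flip i A))\<^sup>2))"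

lemma cube_energy_nonneg: "cube_energy I f \<ge> 0"
  unfolding cube_energy_def by (intro sum_nonneg cube_mean_nonneg) auto

text \<open>On the cube over \<open>insert x I\<close>, \<open>f\<close> equals \<open>g\<close>
  plus the sign of \<open>x\<close> times \<open>h\<close>: these are its parts even and odd in the
  new coordinate. Cross terms cancel in the average over that sign, so squares and energies
  split.\<close>

context
  fixes I :: "'i set" and x :: 'i and f g h :: "'i set \<Rightarrow> real"
  assumes I: "finite I" "x \<notin> I"
    and g: "\<And>A. g A = (f A + f (insert x A)) / 2"
    and h: "\<And>A. h A = (f A - f (insert x A)) / 2"
begin

lemma cube_mean_insert_split: "cube_mean (insert x I) f = cube_mean I g"
  unfolding cube_mean_insert[OF I] by (simp flip: g)

lemma cube_mean_square_insert:
  "cube_mean (insert x I) (\<lambda>A. (f A)\<^sup>2) = cube_mean I (\<lambda>A. (g A)\<^sup>2) + cube_mean I (\<lambda>A. (h A)\<^sup>2)"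
  unfolding cube_mean_insert[OF I] cube_mean_add[symmetric]
  by (rule cube_mean_cong) (simp add: g h power2_eq_square field_simps)

lemma cube_mean_sign_insert: "cube_mean (insert x I) (\<lambda>A. cube_sign A x * f A) = cube_mean I h"
  unfolding cube_mean_insert[OF I]
  by (rule cube_mean_cong) (use I in \<open>auto simp: h cube_sign_def\<close>)

lemma cube_mean_sign_insert_other:
  assumes "i \<in> I"
  shows "cube_mean (insert x I) (\<lambda>A. cube_sign A i * f A) = cube_mean I (\<lambda>A. cube_sign A i * g A)"
  unfolding cube_mean_insert[OF I]
  by (rule cube_mean_cong) (use I assms in \<open>auto simp: g cube_sign_def field_simps\<close>)

text \<open>A flip of an old coordinate acts on \<open>g\<close> and \<open>h\<close> separately.
  The flip of \<open>x\<close> negates only the odd part, so it changes \<open>f\<close> by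
  \<open>2 * h\<close> in absolute value.\<close>

lemma cube_energy_insert:
  "cube_energy (insert x I) f
    = cube_energy I g + cube_energy I h + 4 * cube_mean I (\<lambda>A. (h A)\<^sup>2)"
proof -
  have "cube_mean (insert x I) (\<lambda>A. (f A - f (cube_flip i A))\<^sup>2) =
     cube_mean I (\<lambda>A. (g A - g (cube_flip i A))\<^sup>2) + cube_mean I (\<lambda>A. (h A - h (cube_flip i A))\<^sup>2)"
    if i: "i \<in> I" for i
  proof -
    have *: "cube_flip i (insert x A) = insert x (cube_flip i A)" for A
      using i I by (auto simp: cube_flip_def)
    show ?thesis
      unfolding cube_mean_insert[OF I] cube_mean_add[symmetric] g h *
      by (rule cube_mean_cong) (simp add: power2_eq_square field_simps)
  qed
  moreover have "cube_mean (insert x I) (\<lambda>A. (f A - f (cube_flip x A))\<^sup>2) =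
      4 * cube_mean I (\<lambda>A. (h A)\<^sup>2)"
    unfolding cube_mean_insert[OF I] cube_mean_cmult[symmetric]
  proof (rule cube_mean_cong)
    fix A assume "A \<subseteq> I"
    then have "cube_flip x A = insert x A" "cube_flip x (insert x A) = A"
      using I by (auto simp: cube_flip_def)
    then show "((f A - f (cube_flip x A))\<^sup>2 + (f (insert x A) - f (cube_flip x (insert x A)))\<^sup>2) / 2
        = 4 * (h A)\<^sup>2"
      by (simp add: h power2_eq_square field_simps)
  qed
  ultimately show ?thesis
    using I by (simp add: cube_energy_def sum.distrib)
qed

end

text \<open>This is the spectral gap: every nonconstant Walsh function has energy at least 4. In the
  induction, the term \<open>4 * cube_mean I (\<lambda>A. (h A)\<^sup>2)\<close> pays for the square
  of \<open>h\<close>, and the energy of \<open>h\<close> is dropped.\<close>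

lemma cube_poincare:
  assumes "finite I"
  shows "cube_mean I (\<lambda>A. (f A)\<^sup>2) \<le> (cube_mean I f)\<^sup>2 + cube_energy I f / 4"
  using assms
proof (induction I arbitrary: f)
  case empty
  then show ?case by (simp add: cube_energy_def)
next
  case (insert x I)
  define g h where g: "g A = (f A + f (insert x A)) / 2" and h: "h A = (f A - f (insert x A)) / 2" for A
  note splits = cube_mean_insert_split[where f = f and g = g and h = h, OF insert.hyps g h]
    cube_mean_square_insert[where f = f and g = g and h = h, OF insert.hyps g h]
    cube_energy_insert[where f = f and g = g and h = h, OF insert.hyps g h]
  show ?case
    using insert.IH[of g] cube_energy_nonneg[of I h]
    unfolding splits add_divide_distrib by simp
qed

text \<open>The energy weights the Walsh coefficient of a set \<open>S\<close> by \<open>4 |S|\<close>, so the constant of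
  \<open>cube_poincare\<close> can be halved once the coefficients with \<open>|S| = 1\<close> are accounted for.\<close>

lemma cube_poincare_degree_two:
  assumes "finite I"
  shows "cube_mean I (\<lambda>A. (f A)\<^sup>2) \<le> (cube_mean I f)\<^sup>2 +
    (\<Sum>i\<in>I. (cube_mean I (\<lambda>A. cube_sign A i * f A))\<^sup>2) / 2 + cube_energy I f / 8"
  using assms
proof (induction I arbitrary: f)
  case empty
  then show ?case by (simp add: cube_energy_def)
next
  case (insert x I)
  define g h where g: "g A = (f A + f (insert x A)) / 2" and h: "h A = (f A - f (insert x A)) / 2" for A
  note splits = cube_mean_insert_split[where f = f and g = g and h = h, OF insert.hyps g h]
    cube_mean_square_insert[where f = f and g = g and h = h, OF insert.hyps g h]
    cube_energy_insert[where f = f and g = g and h = h, OF insert.hyps g h]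
    cube_mean_sign_insert[where f = f and g = g and h = h, OF insert.hyps g h]
  have "(\<Sum>i\<in>I. (cube_mean (insert x I) (\<lambda>A. cube_sign A i * f A))\<^sup>2) =
      (\<Sum>i\<in>I. (cube_mean I (\<lambda>A. cube_sign A i * g A))\<^sup>2)"
    by (intro sum.cong refl arg_cong[of _ _ "\<lambda>t. t\<^sup>2"]
      cube_mean_sign_insert_other[where f = f and g = g and h = h, OF insert.hyps g h])
  then have signs: "(\<Sum>i\<in>insert x I. (cube_mean (insert x I) (\<lambda>A. cube_sign A i * f A))\<^sup>2) =
      (cube_mean I h)\<^sup>2 + (\<Sum>i\<in>I. (cube_mean I (\<lambda>A. cube_sign A i * g A))\<^sup>2)"
    using insert.hyps splits(4) by simp
  \<comment> \<open>The odd part already supplies half of the mean square of \<open>h\<close>; half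
    of \<open>cube_poincare\<close> for \<open>h\<close> bounds the other half.\<close>
  show ?case
    using insert.IH[of g] cube_poincare[OF insert.hyps(1), of h]
    unfolding splits(1-3) signs add_divide_distrib by simp
qed

subsection \<open>Khinchine's inequality with constant \<open>\<surd>2\<close>\<close>

text \<open>Orthogonality of the signs. The shift \<open>c\<close> lets the induction absorb the new
  vector as \<open>c + v x\<close> or \<open>c - v x\<close>, and the parallelogram law averages the
  two.\<close>

lemma cube_mean_norm_square:
  fixes v :: "'i \<Rightarrow> 'a :: real_inner"
  assumes "finite I"
  shows "cube_mean I (\<lambda>A. (norm (c + (\<Sum>i\<in>I. cube_sign A i *\<^sub>R v i)))\<^sup>2)
    = (norm c)\<^sup>2 + (\<Sum>i\<in>I. (norm (v i))\<^sup>2)"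
  using assms
proof (induction I arbitrary: c)
  case empty
  then show ?case by simp
next
  case (insert x I)
  let ?S = "\<lambda>A. \<Sum>i\<in>I. cube_sign A i *\<^sub>R v i"
  have "?S (insert x A) = ?S A" for A
    using insert.hyps by (intro sum.cong) (auto simp: cube_sign_def)
  then have "cube_mean (insert x I) (\<lambda>A. (norm (c + (\<Sum>i\<in>insert x I. cube_sign A i *\<^sub>R v i)))\<^sup>2) =
      cube_mean I (\<lambda>A. ((norm ((c + v x) + ?S A))\<^sup>2 + (norm ((c - v x) + ?S A))\<^sup>2) / 2)"
    unfolding cube_mean_insert[OF insert.hyps]
    by (intro cube_mean_cong) (use insert.hyps in \<open>auto simp: cube_sign_def algebra_simps subset_iff\<close>)
  also have "\<dots> = (1/2) * ((norm (c + v x))\<^sup>2 + (\<Sum>i\<in>I. (norm (v i))\<^sup>2)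
      + ((norm (c - v x))\<^sup>2 + (\<Sum>i\<in>I. (norm (v i))\<^sup>2)))"
    unfolding insert.IH[symmetric] cube_mean_add[symmetric] cube_mean_cmult[symmetric] by simp
  also have "\<dots> = (norm c)\<^sup>2 + (\<Sum>i\<in>insert x I. (norm (v i))\<^sup>2)"
    using insert.hyps by (simp add: power2_norm_eq_inner inner_add inner_diff algebra_simps)
  finally show ?case .
qed

theorem khinchine_sqrt2:
  fixes v :: "'i \<Rightarrow> 'a :: real_inner"
  assumes "finite I"
  shows "L2_set (\<lambda>i. norm (v i)) I \<le> sqrt 2 * cube_mean I (\<lambda>A. norm (\<Sum>i\<in>I. cube_sign A i *\<^sub>R v i))"
proof -
  let ?S = "\<lambda>A. \<Sum>i\<in>I. cube_sign A i *\<^sub>R v i"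
  define f where "f A = norm (?S A)" for A
  define M where "M = cube_mean I (\<lambda>A. (f A)\<^sup>2)"
  \<comment> \<open>Complementing the set reverses all signs, so \<open>f\<close> is even and each
    of its degree-one Walsh coefficients equals its own negative.\<close>
  have "f (I - A) = f A" if "A \<subseteq> I" for A
  proof -
    have "?S (I - A) = - ?S A"
      unfolding sum_negf[symmetric] by (intro sum.cong) (use that in \<open>auto simp: cube_sign_def\<close>)
    then show ?thesis by (simp add: f_def)
  qed
  then have "cube_mean I (\<lambda>A. cube_sign (I - A) i * f (I - A)) = - cube_mean I (\<lambda>A. cube_sign A i * f A)"
    if "i \<in> I" for i
    unfolding cube_mean_minus[symmetric]
    by (intro cube_mean_cong) (use that in \<open>auto simp: cube_sign_def\<close>)
  then have odd: "cube_mean I (\<lambda>A. cube_sign A i * f A) = 0" if "i \<in> I" for i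
    using that cube_mean_compl[of I "\<lambda>A. cube_sign A i * f A"] by force
  \<comment> \<open>Among all single flips of \<open>A\<close>, each summand is reversed exactly
    once, so the flipped vector sums add up to \<open>card I - 2\<close> copies of
    \<open>?S A\<close>. For \<open>card I < 2\<close> the factor is negative, and the bound still
    follows since the absolute value dominates it.\<close>
  have flips: "(real (card I) - 2) * f A \<le> (\<Sum>i\<in>I. f (cube_flip i A))" for A
  proof -
    have flip: "?S (cube_flip i A) = ?S A - (2 * cube_sign A i) *\<^sub>R v i" if "i \<in> I" for i
    proof -
      have "?S (cube_flip i A) = cube_sign (cube_flip i A) i *\<^sub>R v i
          + (\<Sum>j\<in>I - {i}. cube_sign (cube_flip i A) j *\<^sub>R v j)"
        using assms that by (simp add: sum.remove)
      also have "(\<Sum>j\<in>I - {i}. cube_sign (cube_flip i A) j *\<^sub>R v j) = (\<Sum>j\<in>I - {i}. cube_sign A j *\<^sub>R v j)"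
        by (intro sum.cong) (auto simp: cube_sign_def cube_flip_def)
      also have "\<dots> = ?S A - cube_sign A i *\<^sub>R v i"
        using assms that by (simp add: sum.remove)
      also have "cube_sign (cube_flip i A) i = - cube_sign A i"
        by (simp add: cube_sign_def cube_flip_def)
      finally show ?thesis
        by (simp add: algebra_simps flip: scaleR_add_left)
    qed
    have "(\<Sum>i\<in>I. ?S (cube_flip i A)) = (\<Sum>i\<in>I. ?S A - (2 * cube_sign A i) *\<^sub>R v i)"
      by (intro sum.cong refl flip)
    also have "\<dots> = (real (card I) - 2) *\<^sub>R ?S A"
      by (simp add: sum_subtractf scaleR_diff_left sum_constant_scaleR flip: scaleR_scaleR scaleR_sum_right)
    finally have "norm (\<Sum>i\<in>I. ?S (cube_flip i A)) = \<bar>real (card I) - 2\<bar> * f A"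
      by (simp add: f_def)
    moreover have "(real (card I) - 2) * f A \<le> \<bar>real (card I) - 2\<bar> * f A"
      by (simp add: f_def mult_right_mono)
    moreover have "norm (\<Sum>i\<in>I. ?S (cube_flip i A)) \<le> (\<Sum>i\<in>I. f (cube_flip i A))"
      unfolding f_def by (rule norm_sum)
    ultimately show ?thesis by linarith
  qed
  \<comment> \<open>Expanding the square and using invariance of the mean under flips turns the
    energy into twice the pairing of \<open>f\<close> with its Laplacian.\<close>
  have "cube_energy I f = (\<Sum>i\<in>I. 2 * M - 2 * cube_mean I (\<lambda>A. f A * f (cube_flip i A)))"
    unfolding cube_energy_def
  proof (intro sum.cong refl)
    fix i assume "i \<in> I"
    have "cube_mean I (\<lambda>A. (f A - f (cube_flip i A))\<^sup>2) = cube_mean I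
        (\<lambda>A. ((f A)\<^sup>2 + (f (cube_flip i A))\<^sup>2) - 2 * (f A * f (cube_flip i A)))"
      by (simp add: power2_diff mult.assoc)
    also have "\<dots> = M + cube_mean I (\<lambda>A. (f (cube_flip i A))\<^sup>2) - 2 * cube_mean I (\<lambda>A. f A * f (cube_flip i A))"
      by (simp add: cube_mean_diff cube_mean_add cube_mean_cmult M_def)
    finally show "cube_mean I (\<lambda>A. (f A - f (cube_flip i A))\<^sup>2)
        = 2 * M - 2 * cube_mean I (\<lambda>A. f A * f (cube_flip i A))"
      using cube_mean_flip[OF \<open>i \<in> I\<close>, of "\<lambda>A. (f A)\<^sup>2"] by (simp add: M_def)
  qed
  also have "\<dots> = 2 * (real (card I) * M - cube_mean I (\<lambda>A. f A * (\<Sum>i\<in>I. f (cube_flip i A))))"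
    by (simp add: sum_subtractf sum_distrib_left cube_mean_sum algebra_simps)
  also have "\<dots> \<le> 2 * (real (card I) * M - (real (card I) - 2) * M)"
  proof -
    have "(real (card I) - 2) * M \<le> cube_mean I (\<lambda>A. f A * (\<Sum>i\<in>I. f (cube_flip i A)))"
      unfolding M_def cube_mean_cmult[symmetric]
    proof (rule cube_mean_mono)
      fix A
      show "(real (card I) - 2) * (f A)\<^sup>2 \<le> f A * (\<Sum>i\<in>I. f (cube_flip i A))"
        using mult_left_mono[OF flips[of A], of "f A"]
        by (simp add: f_def power2_eq_square mult_ac)
    qed
    then show ?thesis by simp
  qed
  finally have "cube_energy I f \<le> 4 * M"
    by (simp add: algebra_simps)
  \<comment> \<open>Since \<open>f\<close> is even, the degree-two inequality reads
    \<open>M \<le> (cube_mean I f)\<^sup>2 + M / 2\<close>; this is the source of the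
    constant.\<close>
  then have "M \<le> 2 * (cube_mean I f)\<^sup>2"
    using cube_poincare_degree_two[OF assms, of f] odd by (simp add: M_def)
  moreover have "M = (\<Sum>i\<in>I. (norm (v i))\<^sup>2)"
    using cube_mean_norm_square[OF assms, of 0 v] by (simp add: M_def f_def)
  ultimately have "L2_set (\<lambda>i. norm (v i)) I \<le> sqrt (2 * (cube_mean I f)\<^sup>2)"
    by (simp add: L2_set_def)
  also have "\<dots> = sqrt 2 * cube_mean I f"
    using cube_mean_nonneg[of I f] by (simp add: real_sqrt_mult f_def)
  finally show ?thesis
    by (simp add: f_def[abs_def])
qed

subsection \<open>Littlewood's \<open>4/3\<close> inequality\<close>

text \<open>Hoelder's inequality for the exponents \<open>1/\<alpha>\<close> and
  \<open>1/\<beta>\<close>: weighted AM-GM is applied to the terms normalised by their total sums,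
  then summed.\<close>

lemma holder_sum_powr:
  fixes u v :: "'i \<Rightarrow> real"
  assumes "0 < \<alpha>" "0 < \<beta>" "\<alpha> + \<beta> = 1"
    and u: "\<And>i. i \<in> I \<Longrightarrow> 0 \<le> u i" and v: "\<And>i. i \<in> I \<Longrightarrow> 0 \<le> v i"
  shows "(\<Sum>i\<in>I. u i powr \<alpha> * v i powr \<beta>) \<le> (\<Sum>i\<in>I. u i) powr \<alpha> * (\<Sum>i\<in>I. v i) powr \<beta>"
proof (cases "finite I \<and> sum u I > 0 \<and> sum v I > 0")
  case True
  define s t where "s = sum u I" and "t = sum v I"
  have st: "s > 0" "t > 0" "finite I"
    using True by (auto simp: s_def t_def)
  have "u i powr \<alpha> * v i powr \<beta> \<le> (s powr \<alpha> * t powr \<beta>) * (\<alpha> * (u i / s) + \<beta> * (v i / t))"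
    if i: "i \<in> I" for i
  proof (cases "u i = 0 \<or> v i = 0")
    case True
    then show ?thesis
      using st u[OF i] v[OF i] assms by (auto intro!: mult_nonneg_nonneg add_nonneg_nonneg)
  next
    case False
    then have pos: "u i > 0" "v i > 0"
      using u[OF i] v[OF i] by auto
    have "(u i / s) powr \<alpha> * (v i / t) powr \<beta> \<le> \<alpha> * (u i / s) + \<beta> * (v i / t)"
      by (intro Youngs_inequality_0) (use assms st pos in auto)
    then have "(s powr \<alpha> * t powr \<beta>) * ((u i / s) powr \<alpha> * (v i / t) powr \<beta>)
        \<le> (s powr \<alpha> * t powr \<beta>) * (\<alpha> * (u i / s) + \<beta> * (v i / t))"
      by (intro mult_left_mono) auto
    then show ?thesis
      using st pos by (simp add: powr_divide)
  qed
  then have "(\<Sum>i\<in>I. u i powr \<alpha> * v i powr \<beta>)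
      \<le> (\<Sum>i\<in>I. (s powr \<alpha> * t powr \<beta>) * (\<alpha> * (u i / s) + \<beta> * (v i / t)))"
    by (rule sum_mono)
  also have "\<dots> = (s powr \<alpha> * t powr \<beta>) * (\<alpha> * (s / s) + \<beta> * (t / t))"
    by (simp add: s_def t_def sum.distrib flip: sum_distrib_left sum_divide_distrib)
  finally show ?thesis
    using st assms by (simp add: s_def t_def)
next
  case False
  \<comment> \<open>For finite \<open>I\<close> one of the nonnegative sums vanishes, hence so do
    all its terms; for infinite \<open>I\<close> sums are 0 by default.\<close>
  have "u i powr \<alpha> * v i powr \<beta> = 0" if "finite I" "i \<in> I" for i
  proof -
    have "sum u I = 0 \<or> sum v I = 0"
      using False that sum_nonneg[of I u] sum_nonneg[of I v] u v by force
    then have "u i = 0 \<or> v i = 0"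
      using that u v sum_nonneg_eq_0_iff[of I u] sum_nonneg_eq_0_iff[of I v] by auto
    then show ?thesis by auto
  qed
  then have "(\<Sum>i\<in>I. u i powr \<alpha> * v i powr \<beta>) = 0"
    by (cases "finite I") (auto intro!: sum.neutral)
  then show ?thesis by simp
qed

lemma L2_set_sum_le: "L2_set (\<lambda>i. \<Sum>j\<in>J. f i j) I \<le> (\<Sum>j\<in>J. L2_set (\<lambda>i. f i j) I)"
proof (induction J rule: infinite_finite_induct)
  case (insert x J)
  then show ?case
    using L2_set_triangle_ineq[of "\<lambda>i. f i x" "\<lambda>i. \<Sum>j\<in>J. f i j" I] by simp
qed (simp_all add: L2_set_def)

text \<open>Interpolation between the mixed norms \<open>\<ell>\<^sub>1(\<ell>\<^sub>2)\<close> of rows and of columns.\<close>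

lemma sum_powr_four_thirds_le:
  fixes b :: "'i \<Rightarrow> 'j \<Rightarrow> real"
  assumes b: "\<And>i j. 0 \<le> b i j"
    and rows: "(\<Sum>i\<in>I. L2_set (\<lambda>j. b i j) J) \<le> K"
    and cols: "(\<Sum>j\<in>J. L2_set (\<lambda>i. b i j) I) \<le> K"
  shows "(\<Sum>i\<in>I. \<Sum>j\<in>J. b i j powr (4/3)) \<le> K powr (4/3)"
proof -
  define R where "R i = L2_set (\<lambda>j. b i j) J" for i
  define L where "L i = (\<Sum>j\<in>J. b i j)" for i
  have R: "R i \<ge> 0" for i
    by (simp add: R_def)
  have L: "L i \<ge> 0" for i
    unfolding L_def by (intro sum_nonneg b)
  have square_powr: "(t\<^sup>2) powr (1/3) = t powr (2/3)" if "t \<ge> 0" for t :: real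
    using that powr_powr[of t 2 "1/3"] by simp
  have K: "K \<ge> 0"
    using rows sum_nonneg[of I R] R by (simp add: R_def)
  \<comment> \<open>Writing \<open>t powr (4/3)\<close> as
    \<open>(t\<^sup>2) powr (1/3) * t powr (2/3)\<close> lets Hoelder bound a row by its
    \<open>\<ell>\<^sub>2\<close> and \<open>\<ell>\<^sub>1\<close> norms, each to the power
    2/3.\<close>
  have row: "(\<Sum>j\<in>J. b i j powr (4/3)) \<le> (L i)\<^sup>2 powr (1/3) * R i powr (2/3)" for i
  proof -
    have "(\<Sum>j\<in>J. b i j powr (4/3)) = (\<Sum>j\<in>J. (b i j)\<^sup>2 powr (1/3) * b i j powr (2/3))"
      by (intro sum.cong) (simp_all add: square_powr b flip: powr_add)
    also have "\<dots> \<le> (\<Sum>j\<in>J. (b i j)\<^sup>2) powr (1/3) * L i powr (2/3)"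
      unfolding L_def by (rule holder_sum_powr) (auto simp: b)
    also have "(\<Sum>j\<in>J. (b i j)\<^sup>2) = (R i)\<^sup>2"
      by (simp add: R_def L2_set_def sum_nonneg)
    finally show ?thesis
      by (simp add: square_powr R L mult.commute)
  qed
  \<comment> \<open>Minkowski's inequality bounds the \<open>\<ell>\<^sub>2\<close> norm of the row
    sums by the sum of the column norms.\<close>
  have "(\<Sum>i\<in>I. (L i)\<^sup>2) = (L2_set L I)\<^sup>2"
    by (simp add: L2_set_def sum_nonneg)
  also have "\<dots> \<le> K\<^sup>2"
    using L2_set_sum_le[of b J I] cols by (intro power_mono) (auto simp: L_def[abs_def])
  finally have col: "(\<Sum>i\<in>I. (L i)\<^sup>2) \<le> K\<^sup>2" .
  \<comment> \<open>A second Hoelder with the same exponents gives \<open>K\<close> the total power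
    2/3 + 2/3.\<close>
  have "(\<Sum>i\<in>I. \<Sum>j\<in>J. b i j powr (4/3)) \<le> (\<Sum>i\<in>I. (L i)\<^sup>2 powr (1/3) * R i powr (2/3))"
    by (intro sum_mono row)
  also have "\<dots> \<le> (\<Sum>i\<in>I. (L i)\<^sup>2) powr (1/3) * (\<Sum>i\<in>I. R i) powr (2/3)"
    by (rule holder_sum_powr) (auto simp: R)
  also have "\<dots> \<le> (K\<^sup>2) powr (1/3) * K powr (2/3)"
    by (intro mult_mono powr_mono2 col sum_nonneg rows[folded R_def]) (auto simp: R)
  also have "\<dots> = K powr (4/3)"
    by (simp add: square_powr K flip: powr_add)
  finally show ?thesis .
qed

text \<open>Khinchine replaces the norm of each row by an average over signs of the columns. For
  fixed signs, taken as \<open>y\<close>, a suitable \<open>x\<close> turns the sum of absolute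
  values into a value of the bilinear form.\<close>

lemma sum_L2_set_rows_le:
  fixes a :: "'i \<Rightarrow> 'j \<Rightarrow> 'k :: {real_normed_field, real_inner}"
  assumes J: "finite J"
    and bound: "\<And>x y. (\<And>i. norm (x i) \<le> 1) \<Longrightarrow> (\<And>j. norm (y j) \<le> 1) \<Longrightarrow>
      norm (\<Sum>i\<in>I. \<Sum>j\<in>J. x i * y j * a i j) \<le> C"
  shows "(\<Sum>i\<in>I. L2_set (\<lambda>j. norm (a i j)) J) \<le> sqrt 2 * C"
proof -
  have signs: "(\<Sum>i\<in>I. norm (\<Sum>j\<in>J. cube_sign A j *\<^sub>R a i j)) \<le> C" for A
  proof -
    define v where "v i = (\<Sum>j\<in>J. cube_sign A j *\<^sub>R a i j)" for i
    \<comment> \<open>The inverse phase of \<open>v i\<close>, so that \<open>x i * v i\<close> is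
      the norm of \<open>v i\<close>; division by zero makes it 0 when
      \<open>v i = 0\<close>.\<close>
    define x :: "'i \<Rightarrow> 'k" where "x i = of_real (norm (v i)) / v i" for i
    have "(\<Sum>i\<in>I. norm (v i)) = norm (of_real (\<Sum>i\<in>I. norm (v i)) :: 'k)"
      by (simp only: norm_of_real) (simp add: sum_nonneg)
    also have "of_real (\<Sum>i\<in>I. norm (v i)) = (\<Sum>i\<in>I. x i * v i)"
      unfolding of_real_sum by (intro sum.cong) (auto simp: x_def)
    also have "\<dots> = (\<Sum>i\<in>I. \<Sum>j\<in>J. x i * of_real (cube_sign A j) * a i j)"
      by (simp add: v_def sum_distrib_left scaleR_conv_of_real mult.assoc)
    also have "norm \<dots> \<le> C"
      by (rule bound) (auto simp: x_def norm_divide cube_sign_def)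
    finally show ?thesis
      by (simp add: v_def)
  qed
  have "(\<Sum>i\<in>I. L2_set (\<lambda>j. norm (a i j)) J)
      \<le> (\<Sum>i\<in>I. sqrt 2 * cube_mean J (\<lambda>A. norm (\<Sum>j\<in>J. cube_sign A j *\<^sub>R a i j)))"
    by (intro sum_mono khinchine_sqrt2 J)
  also have "\<dots> = sqrt 2 * cube_mean J (\<lambda>A. \<Sum>i\<in>I. norm (\<Sum>j\<in>J. cube_sign A j *\<^sub>R a i j))"
    by (simp add: cube_mean_sum sum_distrib_left)
  also have "\<dots> \<le> sqrt 2 * cube_mean J (\<lambda>_. C)"
    by (intro mult_left_mono cube_mean_mono signs) auto
  finally show ?thesis
    using J by (simp add: cube_mean_const)
qed

text \<open>The bound on the bilinear form is symmetric in the two indices, so the row estimate also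
  controls the columns, and interpolation combines both.\<close>

theorem littlewood_four_thirds:
  fixes a :: "'i \<Rightarrow> 'j \<Rightarrow> 'k :: {real_normed_field, real_inner}"
  assumes "finite I" "finite J"
    and bound: "\<And>x y. (\<And>i. norm (x i) \<le> 1) \<Longrightarrow> (\<And>j. norm (y j) \<le> 1) \<Longrightarrow>
      norm (\<Sum>i\<in>I. \<Sum>j\<in>J. x i * y j * a i j) \<le> C"
  shows "(\<Sum>i\<in>I. \<Sum>j\<in>J. norm (a i j) powr (4/3)) \<le> (sqrt 2 * C) powr (4/3)"
proof (rule sum_powr_four_thirds_le)
  show "(\<Sum>i\<in>I. L2_set (\<lambda>j. norm (a i j)) J) \<le> sqrt 2 * C"
    by (rule sum_L2_set_rows_le[OF assms(2)], rule bound) auto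
  show "(\<Sum>j\<in>J. L2_set (\<lambda>i. norm (a i j)) I) \<le> sqrt 2 * C"
  proof (rule sum_L2_set_rows_le)
    fix y :: "'j \<Rightarrow> 'k" and x :: "'i \<Rightarrow> 'k"
    assume "\<And>j. norm (y j) \<le> 1" "\<And>i. norm (x i) \<le> 1"
    then show "norm (\<Sum>j\<in>J. \<Sum>i\<in>I. y j * x i * a i j) \<le> C"
      using bound[of x y] by (subst sum.swap) (simp add: mult_ac)
  qed (rule assms)
qed simp

subsection \<open>Continuous multilinear forms on \<open>c\<^sub>0\<close>\<close>

lemma multilinear_form_add:
  assumes "continuous_multilinear_form m U" "x \<in> {1..m} \<rightarrow>\<^sub>E UNIV" "k \<in> {1..m}"
  shows "U (x(k := y + z)) = U (x(k := y)) + U (x(k := z))"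
proof -
  have "Vector_Spaces.linear c0_scale (*) (\<lambda>y. U (x(k := y)))"
    using assms by (simp add: continuous_multilinear_form_def)
  then show ?thesis
    by (simp add: Vector_Spaces.linear_iff)
qed

lemma multilinear_form_scale:
  assumes "continuous_multilinear_form m U" "x \<in> {1..m} \<rightarrow>\<^sub>E UNIV" "k \<in> {1..m}"
  shows "U (x(k := c0_scale c y)) = c * U (x(k := y))"
proof -
  have "Vector_Spaces.linear c0_scale (*) (\<lambda>y. U (x(k := y)))"
    using assms by (simp add: continuous_multilinear_form_def)
  then show ?thesis
    by (simp add: Vector_Spaces.linear_iff)
qed

lemma multilinear_form_sum:
  assumes "continuous_multilinear_form m U" "x \<in> {1..m} \<rightarrow>\<^sub>E UNIV" "k \<in> {1..m}"
  shows "U (x(k := \<Sum>i\<in>I. c0_scale (c i) (y i))) = (\<Sum>i\<in>I. c i * U (x(k := y i)))"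
proof -
  have zero: "U (x(k := 0)) = 0"
    using multilinear_form_add[OF assms, of 0 0] by simp
  show ?thesis
    by (induction I rule: infinite_finite_induct)
      (simp_all add: zero multilinear_form_add[OF assms] multilinear_form_scale[OF assms] del: fun_upd_apply)
qed

lemma multilinear_form_homogeneous:
  assumes U: "continuous_multilinear_form m U" and x: "x \<in> {1..m} \<rightarrow>\<^sub>E UNIV"
    and J: "finite J" "J \<subseteq> {1..m}"
  shows "U (\<lambda>k. if k \<in> J then c0_scale c (x k) else x k) = c ^ card J * U x"
  using J
proof (induction J rule: finite_induct)
  case (insert k J)
  let ?x = "\<lambda>k. if k \<in> J then c0_scale c (x k) else x k"
  have "?x \<in> {1..m} \<rightarrow>\<^sub>E UNIV"
    using x insert.prems by (auto simp: PiE_def extensional_def)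
  then have "U (?x(k := c0_scale c (x k))) = c * U (?x(k := x k))"
    using insert.prems by (intro multilinear_form_scale[OF U]) auto
  moreover have "?x(k := c0_scale c (x k)) = (\<lambda>i. if i \<in> insert k J then c0_scale c (x i) else x i)"
    by auto
  moreover have "?x(k := x k) = ?x"
    using insert.hyps by auto
  ultimately show ?case
    using insert by (simp add: mult.assoc)
qed simp

lemma norm_c0_scale_le: "norm (c0_scale c y) \<le> norm c * norm y"
  by (rule norm_c0_leI) (simp add: c0_scale.rep_eq norm_mult mult_left_mono norm_c0_nth_le)

text \<open>Continuity at zero bounds \<open>U\<close> on a box containing small balls, and
  homogeneity carries the bound to the unit balls. This makes the supremum in
  \<open>form_norm\<close> an actual upper bound.\<close>

lemma multilinear_form_bdd_above:
  fixes U :: "(nat \<Rightarrow> 'k c0) \<Rightarrow> 'k :: real_normed_field"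
  assumes U: "continuous_multilinear_form m U"
  shows "bdd_above ((\<lambda>x. norm (U x)) ` {x \<in> {1..m} \<rightarrow>\<^sub>E UNIV. \<forall>k \<in> {1..m}. norm (x k) \<le> 1})"
proof -
  let ?T = "product_topology (\<lambda>_. euclidean :: 'k c0 topology) {1..m}"
  define z :: "nat \<Rightarrow> 'k c0" where "z = (\<lambda>k\<in>{1..m}. 0)"
  define S where "S = {x \<in> topspace ?T. U x \<in> ball (U z) 1}"
  have "openin ?T S"
    unfolding S_def
    using U by (intro openin_continuous_map_preimage) (auto simp: continuous_multilinear_form_def)
  moreover have "z \<in> S"
    by (simp add: S_def z_def)
  ultimately have "\<exists>V. finite {i \<in> {1..m}. V i \<noteq> topspace (euclidean :: 'k c0 topology)} \<and>
      (\<forall>i\<in>{1..m}. openin euclidean (V i)) \<and> z \<in> Pi\<^sub>E {1..m} V \<and> Pi\<^sub>E {1..m} V \<subseteq> S"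
    unfolding openin_product_topology_alt by (rule bspec)
  then obtain V where V: "\<forall>i\<in>{1..m}. openin euclidean (V i)" "z \<in> Pi\<^sub>E {1..m} V"
      "Pi\<^sub>E {1..m} V \<subseteq> S"
    by (elim exE conjE)
  have "\<exists>e>0. ball 0 e \<subseteq> V i" if i: "i \<in> {1..m}" for i
  proof -
    have "0 \<in> V i" "open (V i)"
      using V(1) PiE_mem[OF V(2) i] i by (simp_all add: z_def)
    then show ?thesis
      by (meson openE)
  qed
  then obtain e where e: "\<And>i. i \<in> {1..m} \<Longrightarrow> e i > 0 \<and> ball 0 (e i) \<subseteq> V i"
    by metis
  \<comment> \<open>The inserted 1 keeps the set nonempty even for \<open>m = 0\<close>; halving
    makes \<open>d\<close> strictly smaller than every radius.\<close>
  define d where "d = Min (insert 1 (e ` {1..m})) / 2"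
  have d: "d > 0"
    using e by (auto simp: d_def)
  have d_less: "d < e i" if i: "i \<in> {1..m}" for i
  proof -
    have "Min (insert 1 (e ` {1..m})) \<le> e i"
      using i by (intro Min_le) auto
    then show ?thesis
      using e[OF i] by (simp add: d_def)
  qed
  have "norm (U x) \<le> (norm (U z) + 1) / d ^ m"
    if x: "x \<in> {1..m} \<rightarrow>\<^sub>E UNIV" and le: "\<forall>k\<in>{1..m}. norm (x k) \<le> 1" for x
  proof -
    define y where "y = (\<lambda>k. if k \<in> {1..m} then c0_scale (of_real d) (x k) else x k)"
    have "y \<in> Pi\<^sub>E {1..m} V"
    proof (rule PiE_I)
      fix k assume k: "k \<in> {1..m}"
      have "norm (y k) \<le> d * norm (x k)"
        using norm_c0_scale_le[of "of_real d" "x k"] d k by (simp add: y_def)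
      also have "\<dots> \<le> d"
        using le k d by (simp add: mult_left_le)
      also have "\<dots> < e k"
        by (rule d_less[OF k])
      finally show "y k \<in> V k"
        using e[OF k] by auto
    qed (use x in \<open>auto simp: y_def PiE_def extensional_def\<close>)
    then have "dist (U z) (U y) < 1"
      using V(3) by (auto simp: S_def)
    then have "norm (U y) \<le> norm (U z) + 1"
      using norm_triangle_ineq2[of "U y" "U z"] by (simp add: dist_norm norm_minus_commute)
    moreover have "U y = of_real d ^ m * U x"
      using multilinear_form_homogeneous[OF U x, of "{1..m}" "of_real d"] by (simp add: y_def)
    ultimately show ?thesis
      using d by (simp add: norm_mult norm_power field_simps)
  qed
  then show ?thesis
    by (intro bdd_aboveI[of _ "(norm (U z) + 1) / d ^ m"]) auto
qed

lemma norm_le_form_norm: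
  assumes "continuous_multilinear_form m U" "x \<in> {1..m} \<rightarrow>\<^sub>E UNIV" "\<And>k. k \<in> {1..m} \<Longrightarrow> norm (x k) \<le> 1"
  shows "norm (U x) \<le> form_norm m U"
  unfolding form_norm_def
  by (rule cSUP_upper[OF _ multilinear_form_bdd_above]) (use assms in auto)

lemma c0_nth_sum: "c0_nth (\<Sum>i\<in>I. f i) n = (\<Sum>i\<in>I. c0_nth (f i) n)"
  by (induction I rule: infinite_finite_induct) (simp_all add: zero_c0.rep_eq plus_c0.rep_eq)

text \<open>By injectivity each coordinate receives at most one coefficient. Over an infinite
  \<open>I\<close> the sum is 0 by default.\<close>

lemma norm_c0_combination_le:
  fixes c :: "'i \<Rightarrow> 'k :: real_normed_field"
  assumes "inj_on \<phi> I" "\<And>i. i \<in> I \<Longrightarrow> norm (c i) \<le> 1"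
  shows "norm (\<Sum>i\<in>I. c0_scale (c i) (c0_unit (\<phi> i))) \<le> 1"
proof (cases "finite I")
  case True
  show ?thesis
  proof (rule norm_c0_leI)
    fix n
    have nth: "c0_nth (\<Sum>i\<in>I. c0_scale (c i) (c0_unit (\<phi> i))) n = (\<Sum>i\<in>I. if n = \<phi> i then c i else 0)"
      by (auto simp: c0_nth_sum c0_scale.rep_eq c0_unit.rep_eq intro!: sum.cong)
    show "norm (c0_nth (\<Sum>i\<in>I. c0_scale (c i) (c0_unit (\<phi> i))) n) \<le> 1"
    proof (cases "n \<in> \<phi> ` I")
      case True
      then obtain i0 where i0: "i0 \<in> I" "n = \<phi> i0"
        by auto
      have "(\<Sum>i\<in>I. if n = \<phi> i then c i else 0) = (\<Sum>i\<in>I. if i = i0 then c i else 0)"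
        using assms(1) i0 by (intro sum.cong) (auto simp: inj_on_def)
      also have "\<dots> = c i0"
        using \<open>finite I\<close> i0(1) by simp
      finally show ?thesis
        unfolding nth using assms(2)[OF i0(1)] by simp
    next
      case False
      then have "(\<Sum>i\<in>I. if n = \<phi> i then c i else 0) = 0"
        by (intro sum.neutral) auto
      then show ?thesis
        by (simp add: nth)
    qed
  qed
qed simp

subsection \<open>Extracting diagonals by signs\<close>

text \<open>Giving index \<open>x\<close> the sign \<open>t\<close> turns the sum into
  \<open>S + t *\<^sub>R D\<close>, where \<open>t * t = 1\<close> leaves \<open>B x x\<close>
  inside \<open>S\<close>. Averaging over \<open>t = 1\<close> and \<open>t = -1\<close> removes
  \<open>D\<close>. The shift \<open>c\<close> collects the diagonal entries already
  extracted.\<close>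

lemma norm_diagonal_sum_le:
  fixes B :: "'i \<Rightarrow> 'i \<Rightarrow> 'a :: real_normed_vector"
  assumes "finite I"
    and "\<And>r. (\<And>i. \<bar>r i\<bar> = 1) \<Longrightarrow> norm (c + (\<Sum>i\<in>I. \<Sum>j\<in>I. (r i * r j) *\<^sub>R B i j)) \<le> C"
  shows "norm (c + (\<Sum>i\<in>I. B i i)) \<le> C"
  using assms
proof (induction I arbitrary: c rule: finite_induct)
  case empty
  from empty[of "\<lambda>_. 1"] show ?case by simp
next
  case (insert x I)
  have "norm ((c + B x x) + (\<Sum>i\<in>I. B i i)) \<le> C"
  proof (rule insert.IH)
    fix r :: "'i \<Rightarrow> real" assume r: "\<And>i. \<bar>r i\<bar> = 1"
    define S where "S = (c + B x x) + (\<Sum>i\<in>I. \<Sum>j\<in>I. (r i * r j) *\<^sub>R B i j)"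
    define D where "D = (\<Sum>j\<in>I. r j *\<^sub>R B x j) + (\<Sum>i\<in>I. r i *\<^sub>R B i x)"
    have "norm (S + t *\<^sub>R D) \<le> C" if t: "\<bar>t\<bar> = 1" for t
    proof -
      define q where "q = r(x := t)"
      have q: "q x = t" "\<And>i. i \<in> I \<Longrightarrow> q i = r i"
        using insert.hyps by (auto simp: q_def)
      have "norm (c + (\<Sum>i\<in>insert x I. \<Sum>j\<in>insert x I. (q i * q j) *\<^sub>R B i j)) \<le> C"
        by (rule insert.prems) (use r t in \<open>auto simp: q_def\<close>)
      also have "c + (\<Sum>i\<in>insert x I. \<Sum>j\<in>insert x I. (q i * q j) *\<^sub>R B i j) = S + t *\<^sub>R D"
      proof -
        have "t * t = 1"
          using t by (metis abs_mult_self_eq mult_1)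
        then show ?thesis
          using insert.hyps q
          by (simp add: S_def D_def sum.distrib scaleR_sum_right scaleR_add_right mult.commute cong: sum.cong)
      qed
      finally show ?thesis .
    qed
    from this[of 1] this[of "-1"] have "norm (S + D) + norm (S - D) \<le> C + C"
      by simp
    moreover have "norm (2 *\<^sub>R S) \<le> norm (S + D) + norm (S - D)"
      using norm_triangle_ineq[of "S + D" "S - D"] by (simp add: scaleR_2)
    ultimately show "norm ((c + B x x) + (\<Sum>i\<in>I. \<Sum>j\<in>I. (r i * r j) *\<^sub>R B i j)) \<le> C"
      by (simp flip: S_def)
  qed
  then show ?case
    using insert.hyps by (simp add: add.assoc)
qed

text \<open>Diagonals are extracted one index at a time: first \<open>p = i\<close>, then
  \<open>q = j\<close> for fixed signs \<open>r\<close>. The signs enter only as products, so they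
  can later be distributed over separate arguments of a form.\<close>

lemma norm_double_diagonal_sum_le:
  fixes T :: "'i \<Rightarrow> 'j \<Rightarrow> 'i \<Rightarrow> 'j \<Rightarrow> 'a :: real_normed_vector"
  assumes "finite I" "finite J"
    and bound: "\<And>r s. (\<And>i. \<bar>r i\<bar> = 1) \<Longrightarrow> (\<And>j. \<bar>s j\<bar> = 1) \<Longrightarrow>
      norm (\<Sum>i\<in>I. \<Sum>j\<in>J. \<Sum>p\<in>I. \<Sum>q\<in>J. (r i * s j * (r p * s q)) *\<^sub>R T i j p q) \<le> C"
  shows "norm (\<Sum>i\<in>I. \<Sum>j\<in>J. T i j i j) \<le> C"
proof -
  have "norm (0 + (\<Sum>i\<in>I. \<Sum>j\<in>J. T i j i j)) \<le> C"
  proof (rule norm_diagonal_sum_le[where B = "\<lambda>i p. \<Sum>j\<in>J. T i j p j"])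
    fix r :: "'i \<Rightarrow> real" assume r: "\<And>i. \<bar>r i\<bar> = 1"
    have "norm (0 + (\<Sum>j\<in>J. \<Sum>i\<in>I. \<Sum>p\<in>I. (r i * r p) *\<^sub>R T i j p j)) \<le> C"
    proof (rule norm_diagonal_sum_le[where B = "\<lambda>j q. \<Sum>i\<in>I. \<Sum>p\<in>I. (r i * r p) *\<^sub>R T i j p q"])
      fix s :: "'j \<Rightarrow> real" assume s: "\<And>j. \<bar>s j\<bar> = 1"
      have "(\<Sum>j\<in>J. \<Sum>q\<in>J. (s j * s q) *\<^sub>R (\<Sum>i\<in>I. \<Sum>p\<in>I. (r i * r p) *\<^sub>R T i j p q))
          = (\<Sum>i\<in>I. \<Sum>j\<in>J. \<Sum>p\<in>I. \<Sum>q\<in>J. (r i * s j * (r p * s q)) *\<^sub>R T i j p q)"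
        unfolding scaleR_sum_right sum.cartesian_product
        by (rule sum.reindex_bij_witness[where i = "\<lambda>(i, j, p, q). (j, q, i, p)"
              and j = "\<lambda>(j, q, i, p). (i, j, p, q)"]) (auto simp: mult_ac)
      then show "norm (0 + (\<Sum>j\<in>J. \<Sum>q\<in>J. (s j * s q) *\<^sub>R (\<Sum>i\<in>I. \<Sum>p\<in>I. (r i * r p) *\<^sub>R T i j p q))) \<le> C"
        using bound[OF r s] by simp
    qed (rule assms)
    also have "(\<Sum>j\<in>J. \<Sum>i\<in>I. \<Sum>p\<in>I. (r i * r p) *\<^sub>R T i j p j)
        = (\<Sum>i\<in>I. \<Sum>p\<in>I. (r i * r p) *\<^sub>R (\<Sum>j\<in>J. T i j p j))"
      unfolding scaleR_sum_right sum.cartesian_product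
      by (rule sum.reindex_bij_witness[where i = "\<lambda>(i, p, j). (j, i, p)" and j = "\<lambda>(j, i, p). (i, p, j)"]) auto
    finally show "norm (0 + (\<Sum>i\<in>I. \<Sum>p\<in>I. (r i * r p) *\<^sub>R (\<Sum>j\<in>J. T i j p j))) \<le> C" .
  qed (rule assms)
  then show ?thesis by simp
qed

text \<open>Interpolates between free arguments \<open>w\<close> from the third on
  (\<open>l = 0\<close>) and \<open>unit_args\<close> (\<open>l = m - 2\<close>), for an induction
  that fixes one argument at a time.\<close>

definition partial_unit_args ::
    "nat \<Rightarrow> (nat \<Rightarrow> nat \<times> nat \<Rightarrow> nat) \<Rightarrow> (nat \<Rightarrow> 'k c0) \<Rightarrow> nat \<Rightarrow> nat \<Rightarrow> nat \<Rightarrow> 'k :: real_normed_field c0" where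
  "partial_unit_args l \<sigma> w i j = (\<lambda>k. if k = 1 then c0_unit i else if k = 2 then c0_unit j
     else if 3 \<le> k \<and> k < 3 + l then c0_unit (\<sigma> (k - 2) (i, j)) else w k)"

text \<open>Giving the first two arguments random signs \<open>r\<^sub>i\<close> and \<open>s\<^sub>j\<close> and inserting
  \<open>\<Sum> r\<^sub>p s\<^sub>q e\<^bsub>\<tau>(p,q)\<^esub>\<close>, which has norm at most one as \<open>\<tau>\<close> is injective, leaves on average only
  the terms with \<open>(p, q) = (i, j)\<close>.\<close>

lemma norm_partial_unit_args_sum_le:
  fixes U :: "(nat \<Rightarrow> 'k c0) \<Rightarrow> 'k :: real_normed_field"
  assumes U: "continuous_multilinear_form m U" and m: "l + 2 \<le> m"
    and inj: "\<And>k. k \<in> {1..l} \<Longrightarrow> inj (\<sigma> k)"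
    and w: "w \<in> {1..m} \<rightarrow>\<^sub>E UNIV" "\<And>k. k \<in> {1..m} \<Longrightarrow> norm (w k) \<le> 1"
    and x: "\<And>i. norm (x i) \<le> 1" and y: "\<And>j. norm (y j) \<le> 1"
    and fin: "finite I" "finite J"
  shows "norm (\<Sum>i\<in>I. \<Sum>j\<in>J. x i * y j * U (partial_unit_args l \<sigma> w i j)) \<le> form_norm m U"
  using m inj w x y
proof (induction l arbitrary: w x y)
  case 0
  \<comment> \<open>With only the first two arguments tied to \<open>i\<close> and \<open>j\<close>,
    linearity makes the double sum a single value of \<open>U\<close> on unit balls.\<close>
  define X where "X = (\<Sum>i\<in>I. c0_scale (x i) (c0_unit i))"
  define Y where "Y = (\<Sum>j\<in>J. c0_scale (y j) (c0_unit j))"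
  have upd: "v(k := u) \<in> {1..m} \<rightarrow>\<^sub>E UNIV" if "v \<in> {1..m} \<rightarrow>\<^sub>E UNIV" "k \<in> {1..m}" for v k and u :: "'k c0"
    using that by (auto simp: PiE_def extensional_def)
  have "U ((w(2 := Y))(1 := X)) = (\<Sum>i\<in>I. x i * U ((w(2 := Y))(1 := c0_unit i)))"
    unfolding X_def using 0 by (intro multilinear_form_sum[OF U] upd) auto
  also have "\<dots> = (\<Sum>i\<in>I. x i * (\<Sum>j\<in>J. y j * U (w(1 := c0_unit i, 2 := c0_unit j))))"
  proof (intro sum.cong refl arg_cong2[of _ _ _ _ "(*)"])
    fix i
    have "U (w(1 := c0_unit i, 2 := Y)) = (\<Sum>j\<in>J. y j * U (w(1 := c0_unit i, 2 := c0_unit j)))"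
      unfolding Y_def using 0 by (intro multilinear_form_sum[OF U] upd) auto
    moreover have "w(2 := Y, 1 := c0_unit i) = w(1 := c0_unit i, 2 := Y)"
      by (rule fun_upd_twist) simp
    ultimately show "U (w(2 := Y, 1 := c0_unit i)) = (\<Sum>j\<in>J. y j * U (w(1 := c0_unit i, 2 := c0_unit j)))"
      by simp
  qed
  also have "\<dots> = (\<Sum>i\<in>I. \<Sum>j\<in>J. x i * y j * U (partial_unit_args 0 \<sigma> w i j))"
  proof -
    have "partial_unit_args 0 \<sigma> w i j = w(1 := c0_unit i, 2 := c0_unit j)" for i j
      by (auto simp: partial_unit_args_def)
    then show ?thesis
      by (simp add: sum_distrib_left mult.assoc)
  qed
  finally have *: "(\<Sum>i\<in>I. \<Sum>j\<in>J. x i * y j * U (partial_unit_args 0 \<sigma> w i j)) = U ((w(2 := Y))(1 := X))"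
    by simp
  have "norm X \<le> 1" "norm Y \<le> 1"
    using norm_c0_combination_le[of "\<lambda>i. i" I x] norm_c0_combination_le[of "\<lambda>i. i" J y] 0
    by (auto simp: X_def Y_def)
  then show ?case
    unfolding * using 0 by (intro norm_le_form_norm[OF U] upd) auto
next
  case (Suc l)
  \<comment> \<open>The argument newly fixed at stage \<open>Suc l\<close>; indeed
    \<open>k - 2 = Suc l\<close>.\<close>
  define k where "k = 3 + l"
  define \<tau> where "\<tau> = \<sigma> (Suc l)"
  have \<tau>: "inj \<tau>"
    using Suc.prems by (simp add: \<tau>_def)
  have k: "k \<in> {1..m}"
    using Suc.prems by (simp add: k_def)
  let ?a = "\<lambda>i j. partial_unit_args l \<sigma> w i j"
  have PiE: "?a i j \<in> {1..m} \<rightarrow>\<^sub>E UNIV" for i j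
    using Suc.prems by (auto simp: partial_unit_args_def PiE_def extensional_def)
  have upd: "partial_unit_args l \<sigma> (w(k := z)) i j = (?a i j)(k := z)" for z i j
    by (auto simp: partial_unit_args_def k_def)
  have last: "partial_unit_args (Suc l) \<sigma> w i j = (?a i j)(k := c0_unit (\<tau> (i, j)))" for i j
    by (auto simp: partial_unit_args_def k_def \<tau>_def)
  \<comment> \<open>The new argument gets its own index pair \<open>(p, q)\<close>; the wanted sum
    is the diagonal of \<open>T\<close>.\<close>
  define T where "T i j p q = x i * y j * U ((?a i j)(k := c0_unit (\<tau> (p, q))))" for i j p q
  have "norm (\<Sum>i\<in>I. \<Sum>j\<in>J. T i j i j) \<le> form_norm m U"
  proof (rule norm_double_diagonal_sum_le[where T = T, OF fin])
    fix r s :: "nat \<Rightarrow> real"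
    assume r: "\<And>i. \<bar>r i\<bar> = 1" and s: "\<And>j. \<bar>s j\<bar> = 1"
    define c :: "nat \<times> nat \<Rightarrow> 'k" where "c p = of_real (r (fst p) * s (snd p))" for p
    define z where "z = (\<Sum>p\<in>I \<times> J. c0_scale (c p) (c0_unit (\<tau> p)))"
    have "norm z \<le> 1"
      unfolding z_def using \<tau> r s
      by (intro norm_c0_combination_le) (auto simp: c_def abs_mult norm_mult intro: inj_on_subset)
    \<comment> \<open>The induction hypothesis is used with \<open>z\<close> in slot
      \<open>k\<close> of \<open>w\<close> and with the signs absorbed into \<open>x\<close> and
      \<open>y\<close>, which stay in the unit ball.\<close>
    then have "norm (\<Sum>i\<in>I. \<Sum>j\<in>J. (of_real (r i) * x i) * (of_real (s j) * y j)
        * U (partial_unit_args l \<sigma> (w(k := z)) i j)) \<le> form_norm m U"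
      using Suc.prems k r s
      by (intro Suc.IH) (auto simp: norm_mult PiE_def extensional_def)
    also have "(\<Sum>i\<in>I. \<Sum>j\<in>J. (of_real (r i) * x i) * (of_real (s j) * y j)
        * U (partial_unit_args l \<sigma> (w(k := z)) i j))
      = (\<Sum>i\<in>I. \<Sum>j\<in>J. \<Sum>p\<in>I. \<Sum>q\<in>J. (r i * s j * (r p * s q)) *\<^sub>R T i j p q)"
    proof (intro sum.cong refl)
      fix i j
      have "U ((?a i j)(k := z)) = (\<Sum>p\<in>I. \<Sum>q\<in>J. c (p, q) * U ((?a i j)(k := c0_unit (\<tau> (p, q)))))"
        unfolding z_def multilinear_form_sum[OF U PiE k] by (simp add: sum.cartesian_product)
      then show "(of_real (r i) * x i) * (of_real (s j) * y j) * U (partial_unit_args l \<sigma> (w(k := z)) i j)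
          = (\<Sum>p\<in>I. \<Sum>q\<in>J. (r i * s j * (r p * s q)) *\<^sub>R T i j p q)"
        unfolding upd by (simp add: sum_distrib_left scaleR_conv_of_real T_def c_def mult_ac)
    qed
    finally show "norm (\<Sum>i\<in>I. \<Sum>j\<in>J. \<Sum>p\<in>I. \<Sum>q\<in>J. (r i * s j * (r p * s q)) *\<^sub>R T i j p q)
      \<le> form_norm m U" .
  qed
  then show ?case
    unfolding last T_def .
qed

section \<open>From finite rectangles to the infinite double sum\<close>

lemma unit_args_four_thirds:
  fixes U :: "(nat \<Rightarrow> 'k c0) \<Rightarrow> 'k :: {real_normed_field, real_inner}"
  assumes "m \<ge> 2" and \<sigma>: "\<And>k. k \<in> {1..m - 2} \<Longrightarrow> inj (\<sigma> k)"
    and U: "continuous_multilinear_form m U"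
  shows "(\<lambda>p. norm (U (unit_args m \<sigma> p)) powr (4/3)) summable_on UNIV \<and>
    (\<Sum>\<^sub>\<infinity>p\<in>UNIV. norm (U (unit_args m \<sigma> p)) powr (4/3)) powr (3/4) \<le> sqrt 2 * form_norm m U"
proof -
  let ?C = "form_norm m U" and ?f = "\<lambda>p. norm (U (unit_args m \<sigma> p)) powr (4/3)"
  \<comment> \<open>Restriction makes \<open>w\<close> undefined off \<open>{1..m}\<close>, just
    like \<open>unit_args\<close>, so the two argument functions agree everywhere.\<close>
  define w :: "nat \<Rightarrow> 'k c0" where "w = (\<lambda>k\<in>{1..m}. 0)"
  have w: "w \<in> {1..m} \<rightarrow>\<^sub>E UNIV" "\<And>k. k \<in> {1..m} \<Longrightarrow> norm (w k) \<le> 1"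
    by (auto simp: w_def)
  have C: "?C \<ge> 0"
    using norm_le_form_norm[OF U w] norm_ge_zero order_trans by blast
  have args: "partial_unit_args (m - 2) \<sigma> w i j = unit_args m \<sigma> (i, j)" for i j
    using \<open>m \<ge> 2\<close> by (auto simp: partial_unit_args_def unit_args_def w_def fun_eq_iff)
  \<comment> \<open>A finite set of pairs is enlarged to a finite rectangle, where Littlewood's
    inequality applies.\<close>
  have finite_bound: "sum ?f F \<le> (sqrt 2 * ?C) powr (4/3)" if "finite F" for F
  proof -
    have "sum ?f F \<le> sum ?f (fst ` F \<times> snd ` F)"
      using that by (intro sum_mono2 subset_fst_snd) auto
    also have "\<dots> = (\<Sum>i\<in>fst ` F. \<Sum>j\<in>snd ` F. norm (U (unit_args m \<sigma> (i, j))) powr (4/3))"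
      by (simp add: sum.cartesian_product)
    also have "\<dots> \<le> (sqrt 2 * ?C) powr (4/3)"
    proof (rule littlewood_four_thirds)
      fix x y :: "nat \<Rightarrow> 'k"
      assume "\<And>i. norm (x i) \<le> 1" "\<And>j. norm (y j) \<le> 1"
      then show "norm (\<Sum>i\<in>fst ` F. \<Sum>j\<in>snd ` F. x i * y j * U (unit_args m \<sigma> (i, j))) \<le> ?C"
        unfolding args[symmetric] using assms w that
        by (intro norm_partial_unit_args_sum_le[OF U]) auto
    qed (use that in auto)
    finally show ?thesis .
  qed
  have summable: "?f summable_on UNIV"
    using finite_bound
    by (intro nonneg_bdd_above_summable_on bdd_aboveI[of _ "(sqrt 2 * ?C) powr (4/3)"]) auto
  have "infsum ?f UNIV \<le> (sqrt 2 * ?C) powr (4/3)"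
    by (intro infsum_le_finite_sums summable finite_bound)
  then have "infsum ?f UNIV powr (3/4) \<le> ((sqrt 2 * ?C) powr (4/3)) powr (3/4)"
    by (intro powr_mono2 infsum_nonneg) auto
  also have "\<dots> = sqrt 2 * ?C"
    using C by (simp add: powr_powr)
  finally show ?thesis
    using summable by blast
qed

theorem theorem2:
  fixes m :: nat and \<sigma> :: "nat \<Rightarrow> nat \<times> nat \<Rightarrow> nat"
  assumes "m \<ge> 3"
    and "\<And>k. k \<in> {1..m - 2} \<Longrightarrow> bij (\<sigma> k)"
  shows "(\<forall>U :: (nat \<Rightarrow> real c0) \<Rightarrow> real. continuous_multilinear_form m U \<longrightarrow>
            (\<lambda>p. norm (U (unit_args m \<sigma> p)) powr (4/3)) summable_on UNIV \<and>
            (\<Sum>\<^sub>\<infinity>p\<in>UNIV. norm (U (unit_args m \<sigma> p)) powr (4/3)) powr (3/4) \<le> sqrt 2 * form_norm m U) \<and>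
         (\<forall>U :: (nat \<Rightarrow> complex c0) \<Rightarrow> complex. continuous_multilinear_form m U \<longrightarrow>
            (\<lambda>p. norm (U (unit_args m \<sigma> p)) powr (4/3)) summable_on UNIV \<and>
            (\<Sum>\<^sub>\<infinity>p\<in>UNIV. norm (U (unit_args m \<sigma> p)) powr (4/3)) powr (3/4) \<le> sqrt 2 * form_norm m U)"
proof -
  have inj: "inj (\<sigma> k)" if "k \<in> {1..m - 2}" for k
    using assms(2)[OF that] by (rule bij_is_inj)
  have "m \<ge> 2"
    using assms(1) by simp
  \<comment> \<open>Both scalar fields are normed fields with a real inner product, so one statement
    serves both conjuncts.\<close>
  note main = unit_args_four_thirds[OF this inj]
  show ?thesis
    by (intro conjI[where P = "\<forall>U. _ U"] allI impI) (rule main; assumption)+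
qed

end
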